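(* Let $\theta\in(0,1/2)$ be irrational and let $V$ be the unitary on $L^2(\mathbb{R}/\mathbb{Z})$ (with Lebesgue measure) given by $(V\xi)(x)=\xi(x-\theta)$. The following conditions are equivalent for $\lambda,\lambda'\in\mathbb{C}$ with $|\lambda|=|\lambda'|=1$: (1) $\lambda V$ and $\lambda'V$ are unitarily equivalent. (2) $\lambda=e^{2\pi im\theta}\lambda'$ for some $m\in\mathbb{Z}$.
   Context: "$\lambda V$ and $\lambda'V$ are unitarily equivalent" means that there is a unitary $\zeta\in L^\infty(\mathbb{R}/\mathbb{Z})$ (acting by multiplication on $L^2(\mathbb{R}/\mathbb{Z})$) such that $\lambda V=\zeta\lambda'V\zeta^*$. *)

theory Defs
  imports "HOL-Analysis.Analysis"
begin

section \<open>The circle \<open>\<real>/\<int>\<close>\<close>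

quotient_type circle = real / "\<lambda>x y::real. x - y \<in> \<int>"
  morphisms rep_circle to_circle
proof (rule equivpI)
  show "reflp (\<lambda>x y::real. x - y \<in> \<int>)" by (simp add: reflp_def)
  show "symp (\<lambda>x y::real. x - y \<in> \<int>)"
    unfolding symp_def by (metis Ints_minus minus_diff_eq)
  show "transp (\<lambda>x y::real. x - y \<in> \<int>)"
    unfolding transp_def by (metis Ints_add diff_add_cancel add_diff_eq)
qed

instantiation circle :: ab_group_add
begin

lift_definition zero_circle :: circle is 0 .

lift_definition plus_circle :: "circle \<Rightarrow> circle \<Rightarrow> circle" is "(+)"
  by (metis Ints_add add_diff_add)

lift_definition uminus_circle :: "circle \<Rightarrow> circle" is uminus
  by (metis Ints_minus minus_diff_minus)

lift_definition minus_circle :: "circle \<Rightarrow> circle \<Rightarrow> circle" is "(-)"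
proof -
  fix a b c d :: real
  assume "a - b \<in> \<int>" "c - d \<in> \<int>"
  then have "(a - b) - (c - d) \<in> \<int>" by (rule Ints_diff)
  then show "(a - c) - (b - d) \<in> \<int>" by (simp add: algebra_simps)
qed

instance
  by standard (transfer; simp add: algebra_simps)+

end

text \<open>The quotient topology.\<close>

instantiation circle :: topological_space
begin

definition open_circle :: "circle set \<Rightarrow> bool" where
  "open_circle U \<longleftrightarrow> open (to_circle -` U)"

instance
proof
  show "open (UNIV :: circle set)" by (simp add: open_circle_def)
  show "open (S \<inter> T)" if "open S" "open T" for S T :: "circle set"
    using that by (simp add: open_circle_def open_Int)
  show "open (\<Union>K)" if "\<forall>S\<in>K. open S" for K :: "circle set set"
    using that by (auto simp: open_circle_def vimage_Union)
qed

end

text \<open>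
  Lebesgue measure on \<open>\<real>/\<int>\<close>, of total mass 1, as a Borel measure. Using Borel instead of
  Lebesgue measurable functions does not affect the spaces of almost everywhere classes below.
\<close>

definition circle_measure :: "circle measure" where
  "circle_measure = distr (restrict_space lborel {0..<1}) borel to_circle"

lemma to_circle_diff: "to_circle x - to_circle y = to_circle (x - y)"
  by (simp add: minus_circle.abs_eq)

lemma to_circle_eq_iff: "to_circle x = to_circle y \<longleftrightarrow> x - y \<in> \<int>"
  by (rule circle.abs_eq_iff)

lemma to_circle_measurable [measurable]: "to_circle \<in> borel_measurable borel"
  by (rule borel_measurable_continuous_onI) (auto simp: continuous_on_open_vimage open_circle_def)

lemma sets_circle_measure [simp, measurable_cong]: "sets circle_measure = sets borel"
  by (simp add: circle_measure_def)

lemma space_circle_measure [simp]: "space circle_measure = UNIV"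
  by (simp add: circle_measure_def)

lemma to_circle_surj: "\<exists>s\<in>{0..<1}. to_circle s = t"
proof -
  have "to_circle (frac (rep_circle t)) = to_circle (rep_circle t)"
    by (simp add: to_circle_eq_iff frac_def)
  also have "\<dots> = t" by (rule Quotient3_abs_rep[OF Quotient3_circle])
  finally show ?thesis using frac_ge_0 frac_lt_1 by force
qed

lemma diff_circle_measurable [measurable]:
  "(\<lambda>x. x - t) \<in> borel_measurable (borel :: circle measure)"
proof (rule borel_measurable_continuous_onI)
  obtain s where s: "t = to_circle s" using to_circle_surj by metis
  have "open ((\<lambda>x. x - t) -` U)" if "open U" for U :: "circle set"
  proof -
    have "to_circle -` (\<lambda>x. x - t) -` U = (\<lambda>x. x - s) -` (to_circle -` U)"
      by (auto simp: s to_circle_diff)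
    also have "open \<dots>"
      by (rule open_vimage) (use that in \<open>auto simp: open_circle_def intro: continuous_intros\<close>)
    finally show ?thesis by (simp add: open_circle_def)
  qed
  then show "continuous_on UNIV (\<lambda>x. x - t)" by (simp add: continuous_on_open_vimage)
qed

lemma emeasure_circle:
  assumes [measurable]: "A \<in> sets borel"
  shows "emeasure circle_measure A = emeasure lborel ({0..<1} \<inter> to_circle -` A)"
proof -
  have [measurable]: "to_circle \<in> restrict_space lborel {0..<1} \<rightarrow>\<^sub>M borel"
    by (rule measurable_restrict_space1) simp
  show ?thesis
    unfolding circle_measure_def
    by (simp add: emeasure_distr space_restrict_space emeasure_restrict_space Int_commute)
qed

lemma emeasure_lborel_shift:
  fixes c :: real
  assumes [measurable]: "S \<in> sets borel"
  shows "emeasure lborel {x. c + x \<in> S} = emeasure lborel S"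
proof -
  have "emeasure lborel S = emeasure (distr lborel borel ((+) c)) S"
    by (simp add: lborel_distr_plus)
  also have "\<dots> = emeasure lborel {x. c + x \<in> S}"
    by (subst emeasure_distr) (auto simp: vimage_def)
  finally show ?thesis by simp
qed

lemma circle_measure_translate:
  "distr circle_measure circle_measure (\<lambda>x. x - t) = circle_measure"
proof (rule measure_eqI)
  fix A assume "A \<in> sets (distr circle_measure circle_measure (\<lambda>x. x - t))"
  then have A [measurable]: "A \<in> sets borel" by simp
  obtain s where s: "t = to_circle s" "0 \<le> s" "s < 1" using to_circle_surj[of t] by auto
  define B where "B = to_circle -` A"
  have B [measurable]: "B \<in> sets borel"
    unfolding B_def using measurable_sets[OF to_circle_measurable A] by simp
  have per: "x + 1 \<in> B \<longleftrightarrow> x \<in> B" for x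
  proof -
    have "to_circle (x + 1) = to_circle x" by (simp add: to_circle_eq_iff)
    then show ?thesis by (simp add: B_def)
  qed
  have pre [measurable]: "(\<lambda>x. x - t) -` A \<in> sets borel"
    using measurable_sets[OF diff_circle_measurable A] by simp
  have "emeasure (distr circle_measure circle_measure (\<lambda>x. x - t)) A
      = emeasure circle_measure ((\<lambda>x. x - t) -` A)"
    by (subst emeasure_distr) auto
  also have "\<dots> = emeasure lborel ({0..<1} \<inter> to_circle -` (\<lambda>x. x - t) -` A)"
    by (rule emeasure_circle) simp
  also have "{0..<1} \<inter> to_circle -` (\<lambda>x. x - t) -` A = {x. -s + x \<in> {-s..<1-s} \<inter> B}"
    by (auto simp: B_def s to_circle_diff)
  also have "emeasure lborel \<dots> = emeasure lborel ({-s..<1-s} \<inter> B)"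
    by (rule emeasure_lborel_shift) simp
  also have "{-s..<1-s} \<inter> B = ({-s..<0} \<inter> B) \<union> ({0..<1-s} \<inter> B)"
    using s by auto
  also have "emeasure lborel \<dots> = emeasure lborel ({-s..<0} \<inter> B) + emeasure lborel ({0..<1-s} \<inter> B)"
    by (rule plus_emeasure[symmetric]) auto
  also have "{-s..<0} \<inter> B = {x. 1 + x \<in> {1-s..<1} \<inter> B}"
    using per by (auto simp: add.commute)
  also have "emeasure lborel \<dots> = emeasure lborel ({1-s..<1} \<inter> B)"
    by (rule emeasure_lborel_shift) simp
  also have "\<dots> + emeasure lborel ({0..<1-s} \<inter> B)
      = emeasure lborel (({1-s..<1} \<inter> B) \<union> ({0..<1-s} \<inter> B))"
    by (rule plus_emeasure) auto
  also have "({1-s..<1} \<inter> B) \<union> ({0..<1-s} \<inter> B) = {0..<1} \<inter> B"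
    using s by auto
  also have "emeasure lborel \<dots> = emeasure circle_measure A"
    by (simp add: emeasure_circle B_def)
  finally show "emeasure (distr circle_measure circle_measure (\<lambda>x. x - t)) A
      = emeasure circle_measure A" .
qed simp

lemma diff_circle_measure_measurable [measurable]:
  "(\<lambda>x. x - t) \<in> circle_measure \<rightarrow>\<^sub>M circle_measure"
  using diff_circle_measurable by (simp cong: measurable_cong_sets)

lemma AE_circle_translate:
  assumes "AE x in circle_measure. P x"
  shows "AE x in circle_measure. P (x - t)"
proof -
  have "AE x in distr circle_measure circle_measure (\<lambda>x. x - t). P x"
    using assms by (subst circle_measure_translate)
  then show ?thesis by (rule AE_distrD[rotated]) simp
qed

section \<open>\<open>L\<^sup>2(\<real>/\<int>)\<close> and \<open>L\<^sup>\<infinity>(\<real>/\<int>)\<close>\<close>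

definition square_integrable :: "(circle \<Rightarrow> complex) \<Rightarrow> bool" where
  "square_integrable f \<longleftrightarrow> f \<in> borel_measurable circle_measure \<and>
     integrable circle_measure (\<lambda>x. (norm (f x))\<^sup>2)"

definition essentially_bounded :: "(circle \<Rightarrow> complex) \<Rightarrow> bool" where
  "essentially_bounded f \<longleftrightarrow> f \<in> borel_measurable circle_measure \<and>
     (\<exists>C. AE x in circle_measure. norm (f x) \<le> C)"

quotient_type L2 = "circle \<Rightarrow> complex" / partial:
  "\<lambda>f g. square_integrable f \<and> square_integrable g \<and> (AE x in circle_measure. f x = g x)"
  morphisms rep_L2 to_L2
proof (rule part_equivpI)
  show "\<exists>f. square_integrable f \<and> square_integrable f \<and> (AE x in circle_measure. f x = f x)"
    by (rule exI[of _ "\<lambda>_. 0"]) (simp add: square_integrable_def)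
qed (auto simp: symp_def transp_def elim: AE_mp)

quotient_type Linf = "circle \<Rightarrow> complex" / partial:
  "\<lambda>f g. essentially_bounded f \<and> essentially_bounded g \<and> (AE x in circle_measure. f x = g x)"
  morphisms rep_Linf to_Linf
proof (rule part_equivpI)
  show "\<exists>f. essentially_bounded f \<and> essentially_bounded f \<and> (AE x in circle_measure. f x = f x)"
    by (rule exI[of _ "\<lambda>_. 0"]) (auto simp: essentially_bounded_def)
qed (auto simp: symp_def transp_def elim: AE_mp)

lemma square_integrable_bounded_mult:
  assumes "essentially_bounded z" "square_integrable f"
  shows "square_integrable (\<lambda>x. z x * f x)"
proof -
  have [measurable]: "z \<in> borel_measurable circle_measure" "f \<in> borel_measurable circle_measure"
    using assms by (auto simp: essentially_bounded_def square_integrable_def)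
  obtain C where C: "AE x in circle_measure. norm (z x) \<le> C"
    using assms(1) by (auto simp: essentially_bounded_def)
  have "integrable circle_measure (\<lambda>x. C\<^sup>2 * (norm (f x))\<^sup>2)"
    using assms(2) by (auto simp: square_integrable_def)
  then have "integrable circle_measure (\<lambda>x. (norm (z x * f x))\<^sup>2)"
  proof (rule Bochner_Integration.integrable_bound)
    show "AE x in circle_measure. norm ((norm (z x * f x))\<^sup>2) \<le> norm (C\<^sup>2 * (norm (f x))\<^sup>2)"
      using C by eventually_elim
        (auto simp: norm_mult power_mult_distrib intro!: mult_right_mono power_mono)
  qed simp
  then show ?thesis by (simp add: square_integrable_def)
qed

lemma essentially_bounded_const: "essentially_bounded (\<lambda>_. c)"
  by (auto simp: essentially_bounded_def)

lemma essentially_bounded_mult: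
  assumes "essentially_bounded z" "essentially_bounded w"
  shows "essentially_bounded (\<lambda>x. z x * w x)"
proof -
  have [measurable]: "z \<in> borel_measurable circle_measure" "w \<in> borel_measurable circle_measure"
    using assms by (auto simp: essentially_bounded_def)
  obtain C D where C: "AE x in circle_measure. norm (z x) \<le> C"
    and D: "AE x in circle_measure. norm (w x) \<le> D"
    using assms by (auto simp: essentially_bounded_def)
  have "AE x in circle_measure. norm (z x * w x) \<le> \<bar>C\<bar> * \<bar>D\<bar>"
    using C D by eventually_elim (auto simp: norm_mult intro!: mult_mono)
  then show ?thesis by (auto simp: essentially_bounded_def)
qed

lemma essentially_bounded_cnj:
  assumes "essentially_bounded z"
  shows "essentially_bounded (\<lambda>x. cnj (z x))"
proof -
  have "(\<lambda>x. cnj (z x)) \<in> borel_measurable circle_measure"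
    using assms
    by (intro borel_measurable_continuous_on[OF continuous_on_cnj[OF continuous_on_id]])
      (simp add: essentially_bounded_def)
  then show ?thesis using assms by (simp add: essentially_bounded_def)
qed

lemma square_integrable_translate:
  assumes "square_integrable f"
  shows "square_integrable (\<lambda>x. f (x - t))"
proof -
  have [measurable]: "f \<in> borel_measurable circle_measure"
    using assms by (simp add: square_integrable_def)
  have "integrable (distr circle_measure circle_measure (\<lambda>x. x - t)) (\<lambda>x. (norm (f x))\<^sup>2)"
    using assms by (simp add: circle_measure_translate square_integrable_def)
  then show ?thesis
    by (simp add: square_integrable_def integrable_distr_eq)
qed

section \<open>Operators on \<open>L\<^sup>2(\<real>/\<int>)\<close>\<close>

lift_definition Linf_one :: Linf is "\<lambda>_. 1"
  by (simp add: essentially_bounded_const)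

lift_definition Linf_mult :: "Linf \<Rightarrow> Linf \<Rightarrow> Linf" is "\<lambda>z w x. z x * w x"
  by (auto simp: essentially_bounded_mult elim: AE_mp)

lift_definition Linf_star :: "Linf \<Rightarrow> Linf" is "\<lambda>z x. cnj (z x)"
  by (auto simp: essentially_bounded_cnj elim: AE_mp)

definition Linf_unitary :: "Linf \<Rightarrow> bool" where
  "Linf_unitary \<zeta> \<longleftrightarrow> Linf_mult (Linf_star \<zeta>) \<zeta> = Linf_one \<and> Linf_mult \<zeta> (Linf_star \<zeta>) = Linf_one"

lift_definition mult_op :: "Linf \<Rightarrow> L2 \<Rightarrow> L2" is "\<lambda>z \<xi> x. z x * \<xi> x"
  by (auto simp: square_integrable_bounded_mult elim: AE_mp)

lift_definition L2_scale :: "complex \<Rightarrow> L2 \<Rightarrow> L2" is "\<lambda>c \<xi> x. c * \<xi> x"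
  using square_integrable_bounded_mult[OF essentially_bounded_const]
  by (auto elim: AE_mp)

definition scale_op :: "complex \<Rightarrow> (L2 \<Rightarrow> L2) \<Rightarrow> (L2 \<Rightarrow> L2)" where
  "scale_op c T = (\<lambda>\<xi>. L2_scale c (T \<xi>))"

lift_definition V_op :: "real \<Rightarrow> L2 \<Rightarrow> L2" is "\<lambda>\<theta> \<xi> x. \<xi> (x - to_circle \<theta>)"
proof (intro conjI)
  fix \<theta> :: real and f g :: "circle \<Rightarrow> complex"
  assume fg: "square_integrable f \<and> square_integrable g \<and> (AE x in circle_measure. f x = g x)"
  then show "square_integrable (\<lambda>x. f (x - to_circle \<theta>))" "square_integrable (\<lambda>x. g (x - to_circle \<theta>))"
    by (simp_all add: square_integrable_translate)
  show "AE x in circle_measure. f (x - to_circle \<theta>) = g (x - to_circle \<theta>)"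
    using AE_circle_translate[of "\<lambda>x. f x = g x"] fg by blast
qed

definition Linf_unitarily_equivalent :: "(L2 \<Rightarrow> L2) \<Rightarrow> (L2 \<Rightarrow> L2) \<Rightarrow> bool" where
  "Linf_unitarily_equivalent S T \<longleftrightarrow>
     (\<exists>\<zeta>. Linf_unitary \<zeta> \<and> S = mult_op \<zeta> \<circ> T \<circ> mult_op (Linf_star \<zeta>))"

lift_definition L2_inner :: "L2 \<Rightarrow> L2 \<Rightarrow> complex" is
  "\<lambda>\<xi> \<eta>. \<integral>x. \<xi> x * cnj (\<eta> x) \<partial>circle_measure"
proof -
  fix f f' g g' :: "circle \<Rightarrow> complex"
  assume f: "square_integrable f \<and> square_integrable f' \<and> (AE x in circle_measure. f x = f' x)"
    and g: "square_integrable g \<and> square_integrable g' \<and> (AE x in circle_measure. g x = g' x)"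
  have [measurable]: "f \<in> borel_measurable circle_measure" "f' \<in> borel_measurable circle_measure"
    "(\<lambda>x. cnj (g x)) \<in> borel_measurable circle_measure"
    "(\<lambda>x. cnj (g' x)) \<in> borel_measurable circle_measure"
    using f g by (auto simp: square_integrable_def
        intro!: borel_measurable_continuous_on[OF continuous_on_cnj[OF continuous_on_id]])
  have "AE x in circle_measure. f x * cnj (g x) = f' x * cnj (g' x)"
    using conjunct2[OF conjunct2[OF f]] conjunct2[OF conjunct2[OF g]] by eventually_elim simp
  then show "(\<integral>x. f x * cnj (g x) \<partial>circle_measure) = (\<integral>x. f' x * cnj (g' x) \<partial>circle_measure)"
    by (intro integral_cong_AE) simp_all
qed

lemma V_op_V_op: "V_op s (V_op t \<xi>) = V_op (t + s) \<xi>"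
proof (transfer fixing: s t)
  fix f :: "circle \<Rightarrow> complex"
  assume f: "square_integrable f \<and> square_integrable f \<and> (AE x in circle_measure. f x = f x)"
  have "x - to_circle s - to_circle t = x - to_circle (t + s)" for x
    by (simp add: plus_circle.abs_eq[symmetric] diff_diff_eq add.commute)
  moreover have "square_integrable (\<lambda>x. f (x - to_circle (t + s)))"
    using f by (simp add: square_integrable_translate)
  ultimately show "square_integrable (\<lambda>x. f (x - to_circle s - to_circle t)) \<and>
      square_integrable (\<lambda>x. f (x - to_circle (t + s))) \<and>
      (AE x in circle_measure. f (x - to_circle s - to_circle t) = f (x - to_circle (t + s)))"
    by (simp only:) simp
qed

lemma V_op_0: "V_op 0 \<xi> = \<xi>"
proof transfer
  fix f :: "circle \<Rightarrow> complex"
  assume f: "square_integrable f \<and> square_integrable f \<and> (AE x in circle_measure. f x = f x)"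
  then show "square_integrable (\<lambda>x. f (x - to_circle 0)) \<and> square_integrable f \<and>
      (AE x in circle_measure. f (x - to_circle 0) = f x)"
    by (simp add: zero_circle.abs_eq[symmetric])
qed

text \<open>\<open>V\<close> is a unitary: a surjective map preserving inner products.\<close>

lemma V_op_unitary: "bij (V_op \<theta>)" "L2_inner (V_op \<theta> \<xi>) (V_op \<theta> \<eta>) = L2_inner \<xi> \<eta>"
proof -
  show "bij (V_op \<theta>)"
    by (rule o_bij[of "V_op (- \<theta>)"]) (auto simp: fun_eq_iff V_op_V_op V_op_0)
  show "L2_inner (V_op \<theta> \<xi>) (V_op \<theta> \<eta>) = L2_inner \<xi> \<eta>"
  proof (transfer fixing: \<theta>)
    fix f g :: "circle \<Rightarrow> complex"
    assume f: "square_integrable f \<and> square_integrable f \<and> (AE x in circle_measure. f x = f x)"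
      and g: "square_integrable g \<and> square_integrable g \<and> (AE x in circle_measure. g x = g x)"
    have [measurable]: "f \<in> borel_measurable circle_measure"
      "(\<lambda>x. cnj (g x)) \<in> borel_measurable circle_measure"
      using f g by (auto simp: square_integrable_def
          intro!: borel_measurable_continuous_on[OF continuous_on_cnj[OF continuous_on_id]])
    have "(\<integral>x. f x * cnj (g x) \<partial>circle_measure)
        = (\<integral>x. f x * cnj (g x) \<partial>distr circle_measure circle_measure (\<lambda>x. x - to_circle \<theta>))"
      by (simp add: circle_measure_translate)
    also have "\<dots> = (\<integral>x. f (x - to_circle \<theta>) * cnj (g (x - to_circle \<theta>)) \<partial>circle_measure)"
      by (rule integral_distr) simp_all
    finally show "(\<integral>x. f (x - to_circle \<theta>) * cnj (g (x - to_circle \<theta>)) \<partial>circle_measure)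
        = (\<integral>x. f x * cnj (g x) \<partial>circle_measure)" by simp
  qed
qed

end

theory Submission
  imports Defs
begin

text \<open>
  Conjugating \<open>\<lambda>'V\<close> by the multiplication operator of a unitary \<open>\<zeta>\<close> gives
  \<open>\<lambda>'\<zeta>(x) cnj(\<zeta>(x - \<theta>)) V\<close>, so (1) says that \<open>\<lambda> \<zeta>(x - \<theta>) = \<lambda>' \<zeta>(x)\<close> almost everywhere for
  some unimodular \<open>\<zeta>\<close>. Translation by \<open>\<theta>\<close> multiplies the \<open>n\<close>-th Fourier coefficient by a power
  of \<open>e\<^bsup>2\<pi>i\<theta>\<^esup>\<close>, and \<open>\<zeta> \<noteq> 0\<close> has a nonzero Fourier coefficient; comparing the two sides there gives
  (2). Conversely the character \<open>\<zeta>(x) = e\<^bsup>2\<pi>imx\<^esup>\<close> solves the equation.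

  Uniqueness of Fourier coefficients comes from the Stone-Weierstrass theorem: a function with
  vanishing coefficients integrates to zero against all polynomials in the real and imaginary part
  of \<open>e\<^bsup>2\<pi>ix\<^esup>\<close>, hence against continuous functions, hence over closed sets, hence over Borel sets.
\<close>

section \<open>The fundamental character and compactness of the circle\<close>

lift_definition circle_exp :: "circle \<Rightarrow> complex" is "\<lambda>t. cis (2 * pi * t)"
proof -
  fix s t :: real
  assume "s - t \<in> \<int>"
  then obtain n :: int where "s = t + of_int n"
    by (metis Ints_cases add.commute diff_add_cancel)
  then have "cis (2 * pi * s) = cis (2 * pi * t) * cis (2 * pi * of_int n)"
    unfolding cis_mult by (simp add: distrib_left)
  then show "cis (2 * pi * s) = cis (2 * pi * t)"
    by (simp add: cis_multiple_2pi)
qed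

lemma norm_circle_exp [simp]: "norm (circle_exp x) = 1"
  by transfer simp

lemma circle_exp_nonzero [simp]: "circle_exp x \<noteq> 0"
  by (metis norm_circle_exp norm_zero zero_neq_one)

lemma circle_exp_diff: "circle_exp (x - to_circle s) = circle_exp x * cis (- (2 * pi * s))"
  by transfer (simp add: cis_mult algebra_simps)

text \<open>Used to recover a closed subset of the circle from its image in the complex plane, where
  the distance to a set is available.\<close>

lemma inj_circle_exp: "inj circle_exp"
proof (rule injI, transfer)
  fix s t :: real
  assume "cis (2 * pi * s) = cis (2 * pi * t)"
  then have "exp (\<i> * of_real (2 * pi * s)) = exp (\<i> * of_real (2 * pi * t))"
    by (simp add: cis_conv_exp)
  then obtain n :: int where "\<i> * of_real (2 * pi * s) = \<i> * of_real (2 * pi * t) + of_int (2 * n) * pi * \<i>"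
    unfolding exp_eq by blast
  then have "2 * pi * s = 2 * pi * t + 2 * n * pi"
    by (auto simp: complex_eq_iff)
  then have "2 * pi * (s - t) = 2 * pi * n"
    by (simp add: algebra_simps)
  then have "s - t = of_int n"
    by (simp only: mult_cancel_left) auto
  then show "s - t \<in> \<int>"
    by simp
qed

lemma continuous_on_to_circle: "continuous_on A to_circle"
proof -
  have "continuous_on UNIV to_circle"
    by (auto simp: continuous_on_open_vimage open_circle_def)
  then show ?thesis by (rule continuous_on_subset) simp
qed

text \<open>In the quotient topology a set is open iff its preimage in the line is, so continuity
  can be checked after composing with \<open>to_circle\<close>.\<close>

lemma continuous_on_circle_exp: "continuous_on A circle_exp"
proof -
  have "continuous_on UNIV (\<lambda>t. circle_exp (to_circle t))"
    unfolding circle_exp.abs_eq by (intro continuous_intros)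
  then have "continuous_on UNIV circle_exp"
    by (simp add: continuous_on_open_vimage open_circle_def vimage_def)
  then show ?thesis by (rule continuous_on_subset) simp
qed

lemma circle_exp_measurable [measurable]: "circle_exp \<in> borel_measurable borel"
  by (rule borel_measurable_continuous_onI) (rule continuous_on_circle_exp)

lemma compact_UNIV_circle: "compact (UNIV :: circle set)"
proof -
  have "t \<in> to_circle ` {0..1}" for t
    using to_circle_surj[of t] by auto
  then have "UNIV = to_circle ` {0..1}"
    by auto
  then show ?thesis
    by (metis compact_continuous_image compact_Icc continuous_on_to_circle)
qed

lemma emeasure_circle_UNIV: "emeasure circle_measure UNIV = 1"
  using emeasure_circle[of UNIV] by simp

interpretation circle: finite_measure circle_measure
  by standard (simp add: emeasure_circle_UNIV)

section \<open>Functions with vanishing Fourier coefficients\<close>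

text \<open>Integrability is included because the Bochner integral of a non-integrable function is
  0, so such functions would pass the test on coefficients.\<close>

definition fourier_null :: "(circle \<Rightarrow> complex) \<Rightarrow> bool" where
  "fourier_null h \<longleftrightarrow> integrable circle_measure h \<and>
     (\<forall>n::int. (\<integral>x. h x * circle_exp x powi n \<partial>circle_measure) = 0)"

lemma integrable_mult_bounded:
  fixes h k :: "circle \<Rightarrow> complex"
  assumes h: "integrable circle_measure h" and k[measurable]: "k \<in> borel_measurable borel"
    and b: "\<And>x. norm (k x) \<le> C"
  shows "integrable circle_measure (\<lambda>x. k x * h x)"
proof -
  have [measurable]: "h \<in> borel_measurable borel"
    using borel_measurable_integrable[OF h] by simp
  have "integrable circle_measure (\<lambda>x. C * norm (h x))"
    using h by simp
  then show ?thesis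
  proof (rule Bochner_Integration.integrable_bound)
    have "norm (k x * h x) \<le> norm (C * norm (h x))" for x
      using mult_right_mono[OF order_trans[OF b abs_ge_self], of "norm (h x)" x]
      by (simp add: norm_mult abs_mult)
    then show "AE x in circle_measure. norm (k x * h x) \<le> norm (C * norm (h x))" by simp
  qed simp
qed

lemma measurable_circle_powi [measurable]: "(\<lambda>x. circle_exp x powi n) \<in> borel_measurable borel"
  by (rule borel_measurable_continuous_onI) (auto intro!: continuous_intros continuous_on_circle_exp)

lemma integrable_mult_powi:
  assumes "integrable circle_measure h"
  shows "integrable circle_measure (\<lambda>x. h x * circle_exp x powi n)"
  using integrable_mult_bounded[OF assms measurable_circle_powi, of n 1]
  by (simp add: norm_power_int mult.commute)

text \<open>Multiplying by a character only shifts the index of the coefficients.\<close>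

lemma fourier_null_powi:
  assumes "fourier_null h"
  shows "fourier_null (\<lambda>x. circle_exp x powi m * h x)"
proof -
  have "circle_exp x powi m * h x * circle_exp x powi n = h x * circle_exp x powi (m + n)" for x n
    by (simp add: power_int_add)
  then show ?thesis
    using assms integrable_mult_powi[of h m]
    unfolding fourier_null_def by (simp only: mult.commute[of _ "h _"]) simp
qed

lemma fourier_null_scale:
  assumes "fourier_null h"
  shows "fourier_null (\<lambda>x. c * h x)"
  using assms by (simp add: fourier_null_def mult.assoc)

lemma fourier_null_add:
  assumes "fourier_null h" "fourier_null k"
  shows "fourier_null (\<lambda>x. h x + k x)"
  using assms integrable_mult_powi by (simp add: fourier_null_def distrib_right)

text \<open>
  Being universal in \<open>h\<close>, the statement is closed under products of polynomials: apply it first to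
  \<open>h\<close> and then to the resulting function.
\<close>

lemma fourier_null_polynomial:
  assumes "real_polynomial_function f" "fourier_null h"
  shows "fourier_null (\<lambda>x. of_real (f (circle_exp x)) * h x)"
  using assms
proof (induction arbitrary: h)
  case (linear f)
  define c where "c = complex_of_real (f 1)"
  define d where "d = complex_of_real (f \<i>)"
  \<comment> \<open>A real-linear functional is determined by its values on the basis 1,
    \<open>\<i>\<close>. On the unit circle \<open>cnj z\<close> is the inverse of \<open>z\<close>,
    so the functional becomes a trigonometric polynomial with exponents 1 and -1.\<close>
  have f: "of_real (f (circle_exp x)) =
      (c - \<i> * d) / 2 * circle_exp x powi 1 + (c + \<i> * d) / 2 * circle_exp x powi (- 1)" for x
  proof -
    define z where "z = circle_exp x"
    have "f z = f (Re z *\<^sub>R 1 + Im z *\<^sub>R \<i>)"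
      by (rule arg_cong[where f = f]) (simp add: complex_eq_iff)
    also have "\<dots> = Re z * f 1 + Im z * f \<i>"
      using bounded_linear.linear[OF linear(1)] by (simp add: linear_add linear_scale)
    finally have "of_real (f z) = Re z * c + Im z * d"
      by (simp add: c_def d_def)
    also have "\<dots> = (c - \<i> * d) / 2 * z + (c + \<i> * d) / 2 * cnj z"
      by (simp add: complex_eq_iff c_def d_def field_simps)
    also have "cnj z = inverse z"
      unfolding z_def by (rule inverse_unique[symmetric]) (simp add: complex_norm_square[symmetric])
    finally show ?thesis
      by (simp add: power_int_minus z_def)
  qed
  show ?case
    unfolding f distrib_right mult.assoc
    by (intro fourier_null_add fourier_null_scale fourier_null_powi linear)
next
  case (const c)
  then show ?case by (rule fourier_null_scale)
next
  case (add f g)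
  then show ?case by (simp add: distrib_right fourier_null_add)
next
  case (mult f g)
  then show ?case by (simp add: mult.assoc)
qed

text \<open>Replacing \<open>f\<close> by a polynomial changes the integral by at most the uniform
  error on the unit circle times the L1 norm of \<open>h\<close>. Taking \<open>f\<close> on the
  whole plane lets Stone-Weierstrass apply on the compact set \<open>sphere 0 1\<close>.\<close>

lemma fourier_null_continuous:
  assumes h: "fourier_null h" and f: "continuous_on UNIV f"
  shows "(\<integral>x. of_real (f (circle_exp x)) * h x \<partial>circle_measure) = 0"
proof -
  have hi: "integrable circle_measure h" using h by (simp add: fourier_null_def)
  define I where "I = (\<integral>x. norm (h x) \<partial>circle_measure)"
  have [measurable]: "f \<in> borel_measurable borel"
    using f by (rule borel_measurable_continuous_onI)
  have "bounded (f ` sphere 0 1)"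
    by (intro compact_imp_bounded compact_continuous_image continuous_on_subset[OF f]) auto
  then obtain B where "\<forall>z\<in>sphere 0 1. norm (f z) \<le> B"
    unfolding bounded_iff by auto
  then have B: "norm (complex_of_real (f (circle_exp x))) \<le> B" for x by simp
  have fi: "integrable circle_measure (\<lambda>x. of_real (f (circle_exp x)) * h x)"
    by (rule integrable_mult_bounded[OF hi _ B]) measurable
  have I0: "I \<ge> 0" unfolding I_def by simp
  have "norm (\<integral>x. of_real (f (circle_exp x)) * h x \<partial>circle_measure) \<le> 0 + e" if "e > 0" for e
  proof -
    \<comment> \<open>This tolerance times \<open>I\<close> is at most \<open>e\<close>; adding 1
      keeps it positive when \<open>I\<close> is 0.\<close>
    have d: "e / (I + 1) > 0" using that I0 by simp
    obtain g where g: "real_polynomial_function g"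
      and fg: "\<And>z. z \<in> sphere 0 1 \<Longrightarrow> \<bar>f z - g z\<bar> < e / (I + 1)"
      using Stone_Weierstrass_real_polynomial_function[OF compact_sphere continuous_on_subset[OF f] d, of "0::complex" 1]
      by auto
    \<comment> \<open>The plain integral is the coefficient with exponent 0.\<close>
    have g0: "integrable circle_measure (\<lambda>x. of_real (g (circle_exp x)) * h x)"
      "(\<integral>x. of_real (g (circle_exp x)) * h x \<partial>circle_measure) = 0"
            using fourier_null_polynomial[OF g h] unfolding fourier_null_def
      by (simp, metis (no_types, lifting) Bochner_Integration.integral_cong mult.right_neutral power_int_0_right)
    have "norm (\<integral>x. of_real (f (circle_exp x)) * h x \<partial>circle_measure)
       = norm (\<integral>x. of_real (f (circle_exp x)) * h x - of_real (g (circle_exp x)) * h x \<partial>circle_measure)"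
      by (simp add: Bochner_Integration.integral_diff[OF fi g0(1)] g0(2))
    also have "\<dots> \<le> (\<integral>x. e / (I + 1) * norm (h x) \<partial>circle_measure)"
    proof (rule order_trans[OF integral_norm_bound integral_mono])
      fix x
      have "norm (of_real (f (circle_exp x)) * h x - of_real (g (circle_exp x)) * h x)
          = \<bar>f (circle_exp x) - g (circle_exp x)\<bar> * norm (h x)"
        by (simp flip: left_diff_distrib of_real_diff add: norm_mult)
      also have "\<dots> \<le> e / (I + 1) * norm (h x)"
        using fg[of "circle_exp x"] by (intro mult_right_mono) auto
      finally show "norm (of_real (f (circle_exp x)) * h x - of_real (g (circle_exp x)) * h x)
          \<le> e / (I + 1) * norm (h x)" .
    qed (use fi g0 hi in auto)
    also have "\<dots> = e / (I + 1) * I" by (simp add: I_def)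
    also have "\<dots> \<le> e" using that I0 by (simp add: field_simps)
    finally show ?thesis by simp
  qed
  then have "norm (\<integral>x. of_real (f (circle_exp x)) * h x \<partial>circle_measure) \<le> 0"
    by (rule field_le_epsilon)
  then show ?thesis by simp
qed

lemma fourier_null_closed:
  assumes h: "fourier_null h" and C: "closed C"
  shows "(LINT x:C|circle_measure. h x) = 0"
\<comment> \<open>By convention \<open>infdist\<close> to the empty set is 0, so for empty
  \<open>C\<close> the cutoffs below would be constantly 1 instead of tending to the
  indicator.\<close>
proof (cases "C = {}")
  case False
  define K where "K = circle_exp ` C"
  \<comment> \<open>Compactness makes the image \<open>K\<close> closed, so points outside it have
    positive distance from it.\<close>
  have "compact C" using compact_Int_closed[OF compact_UNIV_circle C] by simp
  then have K: "closed K" "K \<noteq> {}"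
    using False unfolding K_def
    by (auto intro!: compact_imp_closed compact_continuous_image continuous_on_circle_exp)
  have inK: "circle_exp x \<in> K \<longleftrightarrow> x \<in> C" for x
    unfolding K_def using inj_circle_exp by (auto dest: injD)
  \<comment> \<open>A continuous cutoff with values in [0, 1]: it is 1 on \<open>K\<close> and, for
    n > 0, vanishes at distance at least 1/n from \<open>K\<close>. Dominated convergence with bound
    \<open>norm (h x)\<close> then reaches the indicator of \<open>C\<close>.\<close>
  define F where "F n z = max 0 (1 - real n * infdist z K)" for n z
  have F01: "0 \<le> F n z" "F n z \<le> 1" for n z
    by (auto simp: F_def infdist_nonneg)
  have Fc: "continuous_on UNIV (F n)" for n
    unfolding F_def by (intro continuous_intros)
  have [measurable]: "F n \<in> borel_measurable borel" for n
    using Fc by (rule borel_measurable_continuous_onI)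
  have [measurable]: "C \<in> sets borel" using C by simp
  have hi: "integrable circle_measure h" using h by (simp add: fourier_null_def)
  have [measurable]: "h \<in> borel_measurable borel"
    using borel_measurable_integrable[OF hi] by simp
  have lim: "(\<lambda>n. F n (circle_exp x)) \<longlonglongrightarrow> indicator C x" for x
  proof (cases "x \<in> C")
    case True
    then have "F n (circle_exp x) = 1" for n using inK[of x] by (simp add: F_def)
    then show ?thesis using True by simp
  next
    case False
    then have d: "infdist (circle_exp x) K > 0" using infdist_pos_not_in_closed[OF K] inK by blast
    obtain N where N: "1 < real N * infdist (circle_exp x) K"
      using reals_Archimedean3[OF d] by blast
    have "F n (circle_exp x) = 0" if "n \<ge> N" for n
      using N mult_right_mono[of "real N" "real n" "infdist (circle_exp x) K"] that d
      unfolding F_def by linarith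
    then have "(\<lambda>n. F n (circle_exp x)) \<longlonglongrightarrow> 0"
      by (intro tendsto_eventually) (auto simp: eventually_sequentially)
    then show ?thesis using False by simp
  qed
  have "(\<lambda>n. \<integral>x. of_real (F n (circle_exp x)) * h x \<partial>circle_measure) \<longlonglongrightarrow>
      (\<integral>x. indicat_real C x *\<^sub>R h x \<partial>circle_measure)"
  proof (rule integral_dominated_convergence[where w = "\<lambda>x. norm (h x)"])
    show "AE x in circle_measure. (\<lambda>n. of_real (F n (circle_exp x)) * h x) \<longlonglongrightarrow> indicat_real C x *\<^sub>R h x"
      unfolding scaleR_conv_of_real by (intro AE_I2 tendsto_intros lim)
    show "AE x in circle_measure. norm (of_real (F n (circle_exp x)) * h x) \<le> norm (h x)" for n
      using F01 by (auto simp: norm_mult intro!: AE_I2 mult_left_le_one_le)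
  qed (use hi in auto)
  then show ?thesis
    unfolding fourier_null_continuous[OF h Fc] set_lebesgue_integral_def
    by (rule LIMSEQ_unique[OF _ tendsto_const])
qed (simp add: set_lebesgue_integral_def)

text \<open>It suffices that \<open>h\<close> integrates to 0 over every Borel set. Closed sets form
  an intersection-stable generator, so Dynkin induction starts from them.\<close>

lemma fourier_uniqueness:
  assumes h: "fourier_null h"
  shows "AE x in circle_measure. h x = 0"
proof (rule circle.density_zero)
  show hi: "integrable circle_measure h" using h by (simp add: fourier_null_def)
  have si: "set_integrable circle_measure A h" if "A \<in> sets borel" for A
    using hi that unfolding set_integrable_def by (intro integrable_mult_indicator) auto
  have sb: "sigma_sets UNIV (Collect closed :: circle set set) = sets borel"
    by (simp add: borel_eq_closed)
  fix A :: "circle set"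
  assume "A \<in> sets circle_measure"
  then have A: "A \<in> sigma_sets UNIV (Collect closed)"
    by (simp add: sb)
  have stable: "Int_stable (Collect closed :: circle set set)"
    by (auto simp: Int_stable_def)
  have sub: "Collect closed \<subseteq> Pow (UNIV :: circle set)"
    by simp
  from A show "(LINT x:A|circle_measure. h x) = 0"
  proof (induction A rule: sigma_sets_induct_disjoint[OF stable sub, consumes 1, case_names basic empty compl union])
    case (basic A)
    then show ?case using fourier_null_closed[OF h] by simp
  next
    case (compl A)
    then have A: "A \<in> sets borel" by (simp add: sb)
    \<comment> \<open>The whole circle is itself closed, so the integral over it is 0 and additivity
      handles the complement.\<close>
    then have "(LINT x:(UNIV - A) \<union> A|circle_measure. h x) =
        (LINT x:UNIV - A|circle_measure. h x) + (LINT x:A|circle_measure. h x)"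
      by (intro set_integral_Un si) auto
    then show ?case using compl fourier_null_closed[OF h closed_UNIV] by simp
  next
    case (union A)
    then have A: "A i \<in> sets borel" for i by (auto simp: sb)
    have "(LINT x:(\<Union>i. A i)|circle_measure. h x) = (\<Sum>i. LINT x:A i|circle_measure. h x)"
      using union A by (intro lebesgue_integral_countable_add si) (auto simp: disjoint_family_on_def)
    then show ?case using union by simp
  qed (auto simp: set_lebesgue_integral_def)
qed


section \<open>From operators to a functional equation\<close>

lemma unitarily_equivalent_scale_V_iff:
  "Linf_unitarily_equivalent (scale_op c (V_op \<theta>)) (scale_op d (V_op \<theta>)) \<longleftrightarrow>
    (\<exists>z. essentially_bounded z \<and> (AE x in circle_measure. cnj (z x) * z x = 1) \<and>
      (AE x in circle_measure. c = d * (z x * cnj (z (x - to_circle \<theta>)))))"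
proof -
  define P where "P \<longleftrightarrow> (\<exists>z. essentially_bounded z \<and> (AE x in circle_measure. cnj (z x) * z x = 1) \<and>
      (AE x in circle_measure. c = d * (z x * cnj (z (x - to_circle \<theta>)))))"
  \<comment> \<open>Testing with the constant 1, square integrable since the measure is finite,
    isolates the equation for \<open>z\<close>; multiplying it by the translate of \<open>f\<close>
    gives the converse.\<close>
  have ae: "(\<forall>f. square_integrable f \<longrightarrow> (AE x in circle_measure. c * f (x - to_circle \<theta>) =
        z x * (d * (cnj (z (x - to_circle \<theta>)) * f (x - to_circle \<theta>))))) \<longleftrightarrow>
      (AE x in circle_measure. c = d * (z x * cnj (z (x - to_circle \<theta>))))" (is "?L \<longleftrightarrow> ?R") for z
  proof
    have "square_integrable (\<lambda>_. 1)"
      by (simp add: square_integrable_def)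
    moreover assume ?L
    ultimately show ?R
      by (auto simp: mult_ac dest: spec[of _ "\<lambda>_. 1"])
  next
    assume R: ?R
    then show ?L
      by (auto elim!: AE_mp simp: mult_ac)
  qed
  have sq: "square_integrable (\<lambda>x. a * f (x - to_circle \<theta>))"
    "essentially_bounded z \<Longrightarrow> square_integrable (\<lambda>x. z x * (d * (cnj (z (x - to_circle \<theta>)) * f (x - to_circle \<theta>))))"
    if "square_integrable f" for a f z
    using that
    by (auto intro!: square_integrable_bounded_mult essentially_bounded_const essentially_bounded_cnj
        square_integrable_translate square_integrable_translate[of "\<lambda>x. cnj (z x) * f x"])
  have comm: "(AE x in circle_measure. z x * cnj (z x) = 1) \<longleftrightarrow> (AE x in circle_measure. cnj (z x) * z x = 1)"
    for z :: "circle \<Rightarrow> complex"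
    by (simp only: mult.commute)
  have "Linf_unitarily_equivalent (scale_op c (V_op \<theta>)) (scale_op d (V_op \<theta>)) \<longleftrightarrow> P"
    unfolding Linf_unitarily_equivalent_def Linf_unitary_def scale_op_def fun_eq_iff o_apply
    \<comment> \<open>Equality of the operators becomes an almost everywhere identity for every
      representative \<open>f\<close>, which \<open>ae\<close> reduces to the equation for
      \<open>z\<close>.\<close>
    by (transfer fixing: c d \<theta> P)
      (simp add: P_def sq comm essentially_bounded_const essentially_bounded_mult essentially_bounded_cnj
        cong: conj_cong flip: ae)
  then show ?thesis by (simp add: P_def)
qed

section \<open>Comparing Fourier coefficients\<close>

text \<open>Translation invariance of the measure leaves only the phase of the character. Its sign
  is positive because \<open>f\<close> is paired with exponent \<open>n\<close>, not
  \<open>-n\<close>.\<close>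

lemma fourier_coeff_translate:
  fixes f :: "circle \<Rightarrow> complex"
  assumes [measurable]: "f \<in> borel_measurable borel"
  shows "(\<integral>x. f (x - to_circle s) * circle_exp x powi n \<partial>circle_measure) =
    cis (2 * pi * n * s) * (\<integral>x. f x * circle_exp x powi n \<partial>circle_measure)"
proof -
  have e: "circle_exp x powi n = cis (2 * pi * n * s) * circle_exp (x - to_circle s) powi n" for x
    by (simp add: circle_exp_diff power_int_mult_distrib cis_power_int cis_mult mult_ac)
  have "(\<integral>x. f x * circle_exp x powi n \<partial>circle_measure)
      = (\<integral>x. f x * circle_exp x powi n \<partial>distr circle_measure circle_measure (\<lambda>x. x - to_circle s))"
    by (simp add: circle_measure_translate)
  also have "\<dots> = (\<integral>x. f (x - to_circle s) * circle_exp (x - to_circle s) powi n \<partial>circle_measure)"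
    by (rule integral_distr) simp_all
  finally have "cis (2 * pi * n * s) * (\<integral>x. f x * circle_exp x powi n \<partial>circle_measure) =
      (\<integral>x. cis (2 * pi * n * s) * (f (x - to_circle s) * circle_exp (x - to_circle s) powi n) \<partial>circle_measure)"
    by simp
  also have "\<dots> = (\<integral>x. f (x - to_circle s) * circle_exp x powi n \<partial>circle_measure)"
    by (subst (2) e) (simp add: mult_ac)
  finally show ?thesis by simp
qed

theorem proposition4p13:
  fixes \<theta> :: real and lam lam' :: complex
  assumes "0 < \<theta>" and "\<theta> < 1/2" and "\<theta> \<notin> \<rat>"
    and "norm lam = 1" and "norm lam' = 1"
  shows "Linf_unitarily_equivalent (scale_op lam (V_op \<theta>)) (scale_op lam' (V_op \<theta>)) \<longleftrightarrow>
    (\<exists>m::int. lam = exp (2 * of_real pi * \<i> * of_int m * of_real \<theta>) * lam')"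
proof -
  have exp_eq: "exp (2 * of_real pi * \<i> * of_int m * of_real \<theta>) = cis (2 * pi * m * \<theta>)" for m :: int
    by (simp add: cis_conv_exp mult_ac)
  show ?thesis
    unfolding unitarily_equivalent_scale_V_iff exp_eq
  proof
    assume "\<exists>z. essentially_bounded z \<and> (AE x in circle_measure. cnj (z x) * z x = 1) \<and>
      (AE x in circle_measure. lam = lam' * (z x * cnj (z (x - to_circle \<theta>))))"
    then obtain z where z: "essentially_bounded z" "AE x in circle_measure. cnj (z x) * z x = 1"
      "AE x in circle_measure. lam = lam' * (z x * cnj (z (x - to_circle \<theta>)))"
      by blast
    from z(1) have "z \<in> borel_measurable circle_measure"
      by (simp add: essentially_bounded_def)
    then have [measurable]: "z \<in> borel_measurable borel"
      by simp
    have norm_z: "AE x in circle_measure. norm (z x) = 1"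
      using z(2)
    proof eventually_elim
      case (elim x)
      then have "norm (z x) ^ 2 = 1"
        by (metis complex_norm_square mult.commute of_real_eq_1_iff)
      then show ?case using norm_ge_zero[of "z x"] by (auto simp: power2_eq_1_iff simp del: norm_ge_zero)
    qed
    then have int: "integrable circle_measure z"
      by (intro circle.integrable_const_bound[where B = 1]) auto
    have "\<not> fourier_null z"
    proof
      assume "fourier_null z"
      from fourier_uniqueness[OF this] norm_z
      have "AE x in circle_measure. False" by eventually_elim simp
      then show False
        using AE_iff_measurable[of UNIV circle_measure "\<lambda>_. False"] by (simp add: emeasure_circle_UNIV)
    qed
    then obtain n :: int where n: "(\<integral>x. z x * circle_exp x powi n \<partial>circle_measure) \<noteq> 0" (is "?I \<noteq> 0")
      using int by (auto simp: fourier_null_def)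
    \<comment> \<open>Multiply the equation by \<open>z (x - to_circle \<theta>)\<close>; the
      unimodularity that cancels the conjugate is needed at the translated point.\<close>
    have ae: "AE x in circle_measure. lam * z (x - to_circle \<theta>) = lam' * z x"
      using z(3) AE_circle_translate[OF z(2), of "to_circle \<theta>"]
    proof eventually_elim
      case (elim x)
      have "lam * z (x - to_circle \<theta>) = lam' * z x * (cnj (z (x - to_circle \<theta>)) * z (x - to_circle \<theta>))"
        using elim(1) by (simp add: mult_ac)
      then show ?case using elim(2) by simp
    qed
    have "lam * (cis (2 * pi * n * \<theta>) * ?I) = (\<integral>x. (lam * z (x - to_circle \<theta>)) * circle_exp x powi n \<partial>circle_measure)"
      using fourier_coeff_translate[of z \<theta> n] by (simp add: mult.assoc)
    also have "\<dots> = (\<integral>x. (lam' * z x) * circle_exp x powi n \<partial>circle_measure)"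
      by (rule integral_cong_AE) (use ae in \<open>auto elim!: AE_mp\<close>)
    also have "\<dots> = lam' * ?I"
      by (simp add: mult.assoc)
    finally have "lam * cis (2 * pi * n * \<theta>) = lam'"
      using n by simp
    \<comment> \<open>Moving the phase to the other side makes \<open>- n\<close> the
      witness.\<close>
    then have "lam = cis (2 * pi * of_int (- n) * \<theta>) * lam'"
      by (simp add: mult.left_commute cis_mult flip: \<open>_ = lam'\<close>)
    then show "\<exists>m::int. lam = cis (2 * pi * m * \<theta>) * lam'"
      by blast
  next
    assume "\<exists>m::int. lam = cis (2 * pi * m * \<theta>) * lam'"
    then obtain m :: int where m: "lam = cis (2 * pi * m * \<theta>) * lam'" ..
    let ?z = "\<lambda>x. circle_exp x powi m"
    have unit: "cnj w * w = 1" if "norm w = 1" for w :: complex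
      using that by (simp add: complex_norm_square[symmetric] mult.commute)
    have u: "cnj (?z x) * ?z x = 1" for x
      by (rule unit) (simp add: norm_power_int)
    have "?z (x - to_circle \<theta>) = cis (- (2 * pi * m * \<theta>)) * ?z x" for x
      by (simp add: circle_exp_diff power_int_mult_distrib cis_power_int mult_ac)
    \<comment> \<open>Conjugation reverses the phase of the translate, which is why the exponent of
      \<open>?z\<close> is \<open>m\<close> and not \<open>- m\<close>.\<close>
    then have "?z x * cnj (?z (x - to_circle \<theta>)) = cis (2 * pi * m * \<theta>) * (cnj (?z x) * ?z x)" for x
      by (simp add: cis_cnj mult_ac)
    then have "lam = lam' * (?z x * cnj (?z (x - to_circle \<theta>)))" for x
      using u m by (simp add: mult.commute[of "cnj _ powi m"])
    moreover have "essentially_bounded ?z"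
      by (auto simp: essentially_bounded_def norm_power_int)
    ultimately show "\<exists>z. essentially_bounded z \<and> (AE x in circle_measure. cnj (z x) * z x = 1) \<and>
      (AE x in circle_measure. lam = lam' * (z x * cnj (z (x - to_circle \<theta>))))"
      using u by (intro exI[of _ ?z]) simp
  qed
qed
end
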